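(* Hercules defeats all hydra: for every hydra $w$, the process that starts with $w$ and repeatedly performs a strike (removal of the first letter followed by regeneration) reaches the empty word after finitely many strikes.
   Context: A hydra is a finite-length positive word on the alphabet $a_1,a_2,a_3,\ldots$ (i.e. a finite word with no inverse letters). A strike transforms a non-empty hydra as follows: its first letter is removed, and then the remaining word regenerates: each remaining letter $a_i$ with $i>1$ is replaced by $a_ia_{i-1}$, and each $a_1$ is left unchanged. For example $a_2a_3a_1\to a_3a_2a_1\to a_2a_1a_1\to a_1a_1\to a_1\to\varepsilon$, where $\varepsilon$ is the empty word. *)

theory Defs
  imports Main
begin

text \<open>The letter $a_i$ is represented by its index \<open>i\<close>; indices start at 1.\<close>

type_synonym word = "nat list"

definition hydra :: "word \<Rightarrow> bool" where
  "hydra w \<longleftrightarrow> (\<forall>i\<in>set w. i \<ge> 1)"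

definition regenerate_letter :: "nat \<Rightarrow> word" where
  "regenerate_letter i = (if i > 1 then [i, i - 1] else [i])"

definition regenerate :: "word \<Rightarrow> word" where
  "regenerate w = concat (map regenerate_letter w)"

text \<open>A strike is only meaningful on a non-empty word. As \<open>tl [] = []\<close>, the total function
  below fixes the empty word, and it cannot make a word empty other than by genuine strikes:
  the least \<open>n\<close> with \<open>(strike ^^ n) w = []\<close> is the number of strikes needed to defeat \<open>w\<close>.\<close>

definition strike :: "word \<Rightarrow> word" where
  "strike w = regenerate (tl w)"

lemma strike_example:
  "strike [2, 3, 1] = [3, 2, 1]"
  "strike [3, 2, 1] = [2, 1, 1]"
  "strike [2, 1, 1] = [1, 1]"
  "strike [1, 1] = [1]"
  "strike [1] = []"
  by (simp_all add: strike_def regenerate_def regenerate_letter_def)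

end

theory Submission
  imports Defs
begin

text \<open>
  Regeneration acts on each letter separately and never creates a letter larger than those present,
  nor a new copy of the largest one. While a prefix \<open>u\<close> of \<open>u @ v\<close> is being struck down, the suffix
  \<open>v\<close> merely regenerates (\<open>strike_prefix_away\<close>). Hence the theorem follows by a double induction: on a
  bound for the letters, and on the number of occurrences of the largest letter \<open>k\<close>. Cut the hydra in
  front of its first \<open>k\<close>. The part before it has smaller letters, so it is eventually struck away;
  by then the rest has grown, but still starts with \<open>k\<close> and contains \<open>k\<close> equally often. One more
  strike removes that \<open>k\<close>, and the inner induction applies, however long the word has become.
\<close>

lemma regenerate_append: "regenerate (u @ v) = regenerate u @ regenerate v"
  by (simp add: regenerate_def)

lemma set_regenerate_le:
  assumes "set w \<subseteq> {..k}"
  shows "set (regenerate w) \<subseteq> {..k}"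
  using assms by (force simp: regenerate_def regenerate_letter_def split: if_splits)

text \<open>Only the letter \<open>Suc k\<close> could spawn a new \<open>k\<close>, so the largest letter keeps its multiplicity.\<close>

lemma count_regenerate_top:
  assumes "set w \<subseteq> {..k}"
  shows "count_list (regenerate w) k = count_list w k"
  using assms by (induction w) (auto simp: regenerate_def regenerate_letter_def)

lemma strike_prefix_away:
  assumes "(strike ^^ n) u = []"
  shows "\<exists>m. (strike ^^ m) (u @ v) = (regenerate ^^ m) v"
  using assms
proof (induction n arbitrary: u v)
  case 0
  then have "(strike ^^ 0) (u @ v) = (regenerate ^^ 0) v" by simp
  then show ?case ..
next
  case (Suc n)
  show ?case
  proof (cases "u = []")
    \<comment> \<open>The prefix may vanish before \<open>n\<close> strikes, and further strikes would then damage \<open>v\<close>.\<close>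
    case True
    then have "(strike ^^ 0) (u @ v) = (regenerate ^^ 0) v" by simp
    then show ?thesis ..
  next
    case False
    have "(strike ^^ n) (strike u) = []"
      using Suc.prems by (simp add: funpow_swap1)
    then obtain m where "(strike ^^ m) (strike u @ regenerate v) = (regenerate ^^ m) (regenerate v)"
      using Suc.IH by blast
    moreover have "strike (u @ v) = strike u @ regenerate v"
      using False by (simp add: strike_def regenerate_append)
    ultimately have "(strike ^^ Suc m) (u @ v) = (regenerate ^^ Suc m) v"
      by (simp add: funpow_swap1)
    then show ?thesis ..
  qed
qed

lemma regenerate_pow_Cons_top:
  assumes "set v \<subseteq> {..k}"
  shows "\<exists>y. (regenerate ^^ m) (k # v) = k # y \<and> set y \<subseteq> {..k} \<and> count_list y k = count_list v k"
proof (induction m)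
  case 0
  then show ?case using assms by simp
next
  case (Suc m)
  then obtain y where y: "(regenerate ^^ m) (k # v) = k # y" "set y \<subseteq> {..k}"
      "count_list y k = count_list v k"
    by blast
  define t where "t = tl (regenerate_letter k)"
  have t: "regenerate_letter k = k # t" "set t \<subseteq> {..k}" "count_list t k = 0"
    by (auto simp: t_def regenerate_letter_def)
  have "(regenerate ^^ Suc m) (k # v) = k # t @ regenerate y"
    using y(1) t(1) by (simp add: regenerate_def)
  moreover have "set (t @ regenerate y) \<subseteq> {..k}"
    using t(2) set_regenerate_le[OF y(2)] by simp
  moreover have "count_list (t @ regenerate y) k = count_list v k"
    using t(3) y(3) count_regenerate_top[OF y(2)] by simp
  ultimately show ?case by blast
qed

text \<open>The strict bound makes the empty word the only base case of the outer induction.\<close>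

lemma bounded_word_defeated:
  assumes "set w \<subseteq> {..<k}"
  shows "\<exists>n. (strike ^^ n) w = []"
  using assms
proof (induction k arbitrary: w)
  case 0
  then have "(strike ^^ 0) w = []" by simp
  then show ?case ..
next
  case (Suc k)
  note smaller = Suc.IH
  from Suc.prems have "set w \<subseteq> {..k}" by (simp add: lessThan_Suc_atMost)
  then show ?case
  proof (induction "count_list w k" arbitrary: w)
    case 0
    then have "k \<notin> set w" by (simp add: count_list_0_iff)
    with 0 have "set w \<subseteq> {..<k}" by (auto simp: le_less)
    then show ?case by (rule smaller)
  next
    case (Suc c)
    then have "k \<in> set w" by (metis count_notin nat.distinct(1))
    then obtain u v where w: "w = u @ k # v" and "k \<notin> set u"
      using split_list_first by metis
    then have "set u \<subseteq> {..<k}" and v: "set v \<subseteq> {..k}"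
      using Suc.prems by (auto simp: le_less)
    then obtain n where "(strike ^^ n) u = []"
      using smaller by blast
    then obtain m where "(strike ^^ m) w = (regenerate ^^ m) (k # v)"
      using strike_prefix_away w by blast
    then obtain y where y: "(strike ^^ m) w = k # y" "set y \<subseteq> {..k}"
        "count_list y k = count_list v k"
      using regenerate_pow_Cons_top[OF v] by metis
    have "count_list v k = c"
      using Suc.hyps(2) w \<open>k \<notin> set u\<close> by simp
    then have "c = count_list (regenerate y) k"
      using y count_regenerate_top by simp
    then obtain l where "(strike ^^ l) (regenerate y) = []"
      using Suc.hyps(1) set_regenerate_le[OF y(2)] by blast
    moreover have "(strike ^^ Suc m) w = regenerate y"
      using y(1) by (simp add: strike_def)
    ultimately have "(strike ^^ (l + Suc m)) w = []"
      by (simp only: funpow_add o_apply)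
    then show ?case ..
  qed
qed

theorem proposition1p1:
  fixes w :: word
  assumes "hydra w"
  shows "\<exists>n. (strike ^^ n) w = []"
proof (rule bounded_word_defeated)
  show "set w \<subseteq> {..<Suc (Max (set w))}"
    by (auto simp: less_Suc_eq_le)
qed

end
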